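(* Let $p$ be an odd prime and $n$ a positive integer. Every symmetric $(n-1)\times(n-1)$ matrix with coefficients in $\mathbb{Z}_p$ of maximal rank is the defining matrix, with respect to a suitable basis, of a commutative, torsion-free and $3$-nilpotent $\mathbb{Z}_p$-algebra $(M,+,\cdot)$ (with $M$ free of rank $n$ over $\mathbb{Z}_p$) such that $\mathrm{Ann}(M)$ is cyclic.
   Context: $\mathbb{Z}_p$ is the ring of $p$-adic integers. Algebras are associative and commutative. $(M,+,\cdot)$ is $3$-nilpotent if $M\cdot M\cdot M=0$. $\mathrm{Ann}(M)=\{a\in M : a\cdot x=0\ \forall x\in M\}$; cyclic means cyclic as a $\mathbb{Z}_p$-module. Maximal rank means rank $n-1$ (equivalently, nonzero determinant). Defining matrix: let $(M,+,\cdot)$ be a commutative $3$-nilpotent $\mathbb{Z}_p$-algebra, free of rank $n$ as a $\mathbb{Z}_p$-module, with $\mathrm{Ann}(M)$ cyclic. Then $M\cdot M\subseteq\mathrm{Ann}(M)$, and there is a basis $e_1,\dots,e_n$ of $M$ with $\mathrm{Ann}(M)=\mathbb{Z}_p e_n$. The defining matrix in such a basis is the $(n-1)\times(n-1)$ matrix $\Theta=(\Theta_{i,j})$ with $e_i\cdot e_j=\Theta_{i,j}e_n$ for $1\le i,j\le n-1$. *)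

theory Defs
  imports
    "HOL-Computational_Algebra.Primes"
    "HOL-Algebra.Module"
    "Jordan_Normal_Form.Matrix"
    "Jordan_Normal_Form.Missing_VectorSpace"
begin

section \<open>The ring of p-adic integers\<close>

text \<open>The inverse limit of the rings of integers modulo \<open>p ^ k\<close>: an element is a compatible
  sequence of canonical representatives \<open>x k \<in> {0..<p ^ k}\<close>.\<close>

definition padic_integers :: "nat \<Rightarrow> (nat \<Rightarrow> int) ring" where
  "padic_integers p =
     \<lparr>carrier = {x. \<forall>k. x k \<in> {0..<int p ^ k} \<and> x (Suc k) mod int p ^ k = x k},
      mult = (\<lambda>x y k. (x k * y k) mod int p ^ k),
      one = (\<lambda>k. 1 mod int p ^ k),
      zero = (\<lambda>k. 0),
      add = (\<lambda>x y k. (x k + y k) mod int p ^ k)\<rparr>"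

lemma padic_carrierI:
  assumes "p > 0" "\<And>k. a (Suc k) mod int p ^ k = a k mod int p ^ k"
  shows "(\<lambda>k. a k mod int p ^ k) \<in> carrier (padic_integers p)"
proof -
  have "a (Suc k) mod int p ^ Suc k mod int p ^ k = a k mod int p ^ k" for k
    using assms(2)[of k] by (simp add: mod_mod_cancel)
  then show ?thesis using assms(1) by (simp add: padic_integers_def)
qed

lemma padic_mod:
  assumes "x \<in> carrier (padic_integers p)"
  shows "x k mod int p ^ k = x k" "x (Suc k) mod int p ^ k = x k"
  using assms by (simp_all add: padic_integers_def)

lemma padic_integers_cring:
  assumes "p > 0"
  shows "cring (padic_integers p)"
proof (rule cringI)
  let ?R = "padic_integers p"
  have add: "x \<oplus>\<^bsub>?R\<^esub> y = (\<lambda>k. (x k + y k) mod int p ^ k)" for x y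
    by (simp add: padic_integers_def)
  have mul: "x \<otimes>\<^bsub>?R\<^esub> y = (\<lambda>k. (x k * y k) mod int p ^ k)" for x y
    by (simp add: padic_integers_def)
  have one: "\<one>\<^bsub>?R\<^esub> = (\<lambda>k. 1 mod int p ^ k)" and zero: "\<zero>\<^bsub>?R\<^esub> = (\<lambda>k. 0)"
    by (simp_all add: padic_integers_def)
  have addc: "x \<oplus>\<^bsub>?R\<^esub> y \<in> carrier ?R" if "x \<in> carrier ?R" "y \<in> carrier ?R" for x y
    unfolding add by (rule padic_carrierI[OF assms], subst mod_add_eq[symmetric])
      (simp only: padic_mod[OF that(1)] padic_mod[OF that(2)])
  have mulc: "x \<otimes>\<^bsub>?R\<^esub> y \<in> carrier ?R" if "x \<in> carrier ?R" "y \<in> carrier ?R" for x y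
    unfolding mul by (rule padic_carrierI[OF assms], subst mod_mult_eq[symmetric])
      (simp only: padic_mod[OF that(1)] padic_mod[OF that(2)])
  have onec: "\<one>\<^bsub>?R\<^esub> \<in> carrier ?R"
    unfolding one by (rule padic_carrierI[OF assms]) simp
  have zeroc: "\<zero>\<^bsub>?R\<^esub> \<in> carrier ?R"
    using assms by (simp add: padic_integers_def)
  show "abelian_group ?R"
  proof (rule abelian_groupI)
    fix x assume x: "x \<in> carrier ?R"
    have "(\<lambda>k. (- x k) mod int p ^ k) \<in> carrier ?R"
      by (rule padic_carrierI[OF assms], subst mod_minus_eq[symmetric]) (simp only: padic_mod[OF x])
    moreover have "(\<lambda>k. (- x k) mod int p ^ k) \<oplus>\<^bsub>?R\<^esub> x = \<zero>\<^bsub>?R\<^esub>"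
      by (simp add: add zero mod_simps)
    ultimately show "\<exists>y\<in>carrier ?R. y \<oplus>\<^bsub>?R\<^esub> x = \<zero>\<^bsub>?R\<^esub>" by blast
  qed (use addc zeroc in \<open>simp_all add: add zero mod_simps ac_simps padic_mod(1)\<close>)
  show "comm_monoid ?R"
    by (rule comm_monoidI)
      (use mulc onec in \<open>simp_all add: mul one mod_simps ac_simps padic_mod(1)\<close>)
  fix x y z
  show "(x \<oplus>\<^bsub>?R\<^esub> y) \<otimes>\<^bsub>?R\<^esub> z = x \<otimes>\<^bsub>?R\<^esub> z \<oplus>\<^bsub>?R\<^esub> y \<otimes>\<^bsub>?R\<^esub> z"
    by (simp add: add mul mod_simps algebra_simps)
qed


section \<open>Commutative algebras, not necessarily unital\<close>

text \<open>The locale \<open>algebra\<close> of HOL-Algebra requires a unit, which a nonzero nilpotent algebra cannot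
  have. The field \<open>one\<close> of the record \<open>M\<close> is unconstrained here and plays no role.\<close>

locale comm_nonunital_algebra = module R M for R (structure) and M (structure) +
  assumes mult_closed:
      "\<lbrakk>x \<in> carrier M; y \<in> carrier M\<rbrakk> \<Longrightarrow> x \<otimes>\<^bsub>M\<^esub> y \<in> carrier M"
    and mult_assoc:
      "\<lbrakk>x \<in> carrier M; y \<in> carrier M; z \<in> carrier M\<rbrakk>
        \<Longrightarrow> (x \<otimes>\<^bsub>M\<^esub> y) \<otimes>\<^bsub>M\<^esub> z = x \<otimes>\<^bsub>M\<^esub> (y \<otimes>\<^bsub>M\<^esub> z)"
    and mult_comm:
      "\<lbrakk>x \<in> carrier M; y \<in> carrier M\<rbrakk> \<Longrightarrow> x \<otimes>\<^bsub>M\<^esub> y = y \<otimes>\<^bsub>M\<^esub> x"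
    and mult_distrib:
      "\<lbrakk>x \<in> carrier M; y \<in> carrier M; z \<in> carrier M\<rbrakk>
        \<Longrightarrow> (x \<oplus>\<^bsub>M\<^esub> y) \<otimes>\<^bsub>M\<^esub> z = x \<otimes>\<^bsub>M\<^esub> z \<oplus>\<^bsub>M\<^esub> y \<otimes>\<^bsub>M\<^esub> z"
    and mult_smult:
      "\<lbrakk>r \<in> carrier R; x \<in> carrier M; y \<in> carrier M\<rbrakk>
        \<Longrightarrow> (r \<odot>\<^bsub>M\<^esub> x) \<otimes>\<^bsub>M\<^esub> y = r \<odot>\<^bsub>M\<^esub> (x \<otimes>\<^bsub>M\<^esub> y)"

definition three_nilpotent :: "('a, 'm, 'b) module_scheme \<Rightarrow> bool" where
  "three_nilpotent M \<longleftrightarrow>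
     (\<forall>x\<in>carrier M. \<forall>y\<in>carrier M. \<forall>z\<in>carrier M. x \<otimes>\<^bsub>M\<^esub> y \<otimes>\<^bsub>M\<^esub> z = \<zero>\<^bsub>M\<^esub>)"

definition torsion_free :: "('a, 'c) ring_scheme \<Rightarrow> ('a, 'm, 'b) module_scheme \<Rightarrow> bool" where
  "torsion_free R M \<longleftrightarrow>
     (\<forall>r\<in>carrier R. \<forall>x\<in>carrier M. r \<odot>\<^bsub>M\<^esub> x = \<zero>\<^bsub>M\<^esub> \<longrightarrow> r = \<zero>\<^bsub>R\<^esub> \<or> x = \<zero>\<^bsub>M\<^esub>)"

definition Ann :: "('a, 'm, 'b) module_scheme \<Rightarrow> 'm set" where
  "Ann M = {a \<in> carrier M. \<forall>x\<in>carrier M. a \<otimes>\<^bsub>M\<^esub> x = \<zero>\<^bsub>M\<^esub>}"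

definition cyclic_submodule ::
    "('a, 'c) ring_scheme \<Rightarrow> ('a, 'm, 'b) module_scheme \<Rightarrow> 'm set \<Rightarrow> bool" where
  "cyclic_submodule R M N \<longleftrightarrow> (\<exists>a\<in>carrier M. N = module.span R M {a})"

text \<open>Indices run from \<open>0\<close> to \<open>n - 1\<close>. Injectivity excludes repetitions, which the set
  \<open>e ` {..<n}\<close> does not see.\<close>

definition ordered_basis ::
    "('a, 'c) ring_scheme \<Rightarrow> ('a, 'm, 'b) module_scheme \<Rightarrow> nat \<Rightarrow> (nat \<Rightarrow> 'm) \<Rightarrow> bool" where
  "ordered_basis R M n e \<longleftrightarrow>
     inj_on e {..<n} \<and> e ` {..<n} \<subseteq> carrier M \<and>
     module.lin_indpt R M (e ` {..<n}) \<and> module.gen_set R M (e ` {..<n})"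

text \<open>With indices starting at \<open>0\<close>, the last basis vector, which spans the annihilator, is
  \<open>e (n - 1)\<close>.\<close>

definition defining_matrix ::
    "('a, 'c) ring_scheme \<Rightarrow> ('a, 'm, 'b) module_scheme \<Rightarrow> nat \<Rightarrow> (nat \<Rightarrow> 'm) \<Rightarrow> 'a mat \<Rightarrow> bool" where
  "defining_matrix R M n e A \<longleftrightarrow>
     ordered_basis R M n e \<and> Ann M = module.span R M {e (n - 1)} \<and>
     A \<in> carrier_mat (n - 1) (n - 1) \<and> elements_mat A \<subseteq> carrier R \<and>
     (\<forall>i<n - 1. \<forall>j<n - 1. e i \<otimes>\<^bsub>M\<^esub> e j = A $$ (i, j) \<odot>\<^bsub>M\<^esub> e (n - 1))"


section \<open>The rank of a matrix over a domain\<close>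

definition independent_cols :: "('a, 'c) ring_scheme \<Rightarrow> 'a mat \<Rightarrow> nat set \<Rightarrow> bool" where
  "independent_cols R A J \<longleftrightarrow>
     (\<forall>c \<in> J \<rightarrow> carrier R.
        (\<forall>i<dim_row A. (\<Oplus>\<^bsub>R\<^esub>j\<in>J. c j \<otimes>\<^bsub>R\<^esub> A $$ (i, j)) = \<zero>\<^bsub>R\<^esub>) \<longrightarrow> (\<forall>j\<in>J. c j = \<zero>\<^bsub>R\<^esub>))"

text \<open>The maximal number of linearly independent columns. Over a domain this is the rank over the
  fraction field, since a linear relation can be cleared of denominators.\<close>

definition mat_rank :: "('a, 'c) ring_scheme \<Rightarrow> 'a mat \<Rightarrow> nat" where
  "mat_rank R A = Max {card J | J. J \<subseteq> {..<dim_col A} \<and> independent_cols R A J}"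

end

theory Submission
  imports Defs
begin

text \<open>The form \<open>\<Theta>\<close> is transplanted to the free module of rank \<open>n\<close>: the product of two vectors is the
  value of \<open>\<Theta>\<close> on their first \<open>n - 1\<close> coordinates, placed in the last coordinate. Since products only
  have a last coordinate and factors only contribute their first \<open>n - 1\<close> coordinates, triple products
  vanish. Multiplying \<open>y\<close> by the \<open>i\<close>-th unit vector gives the \<open>i\<close>-th entry of \<open>\<Theta>y\<close>, so, as the
  columns of \<open>\<Theta>\<close> are independent, the annihilator is exactly the last coordinate axis.\<close>

section \<open>The p-adic integers as a domain, and matrices of maximal rank\<close>

lemma padic_integers_domain:
  assumes p: "prime p"
  shows "domain (padic_integers p)"
proof -
  let ?R = "padic_integers p"
  interpret R: cring ?R
    by (rule padic_integers_cring) (use p prime_gt_0_nat in blast)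
  \<comment> \<open>The definition of the carrier compares neighbouring levels only; iterating it
    links level k + l to level k.\<close>
  have coherent: "x (k + l) mod int p ^ k = x k" if x: "x \<in> carrier ?R" for x k l
  proof (induction l)
    case 0
    show ?case using padic_mod(1)[OF x] by simp
  next
    case (Suc l)
    have "x (k + Suc l) mod int p ^ k = x (k + Suc l) mod int p ^ (k + l) mod int p ^ k"
      by (simp add: mod_mod_cancel power_add)
    then show ?case using padic_mod(2)[OF x, of "k + l"] Suc by simp
  qed
  show ?thesis
  proof
    \<comment> \<open>Level 1 is the first that separates 1 from 0, since modulo p ^ 0 every residue
      is 0.\<close>
    have "(1::int) mod int p ^ 1 = 1"
      using prime_gt_1_nat[OF p] by simp
    then show "\<one>\<^bsub>?R\<^esub> \<noteq> \<zero>\<^bsub>?R\<^esub>"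
      unfolding padic_integers_def by (auto simp: fun_eq_iff intro!: exI[of _ 1])
  next
    fix x y
    assume xy: "x \<otimes>\<^bsub>?R\<^esub> y = \<zero>\<^bsub>?R\<^esub>" and x: "x \<in> carrier ?R" and y: "y \<in> carrier ?R"
    show "x = \<zero>\<^bsub>?R\<^esub> \<or> y = \<zero>\<^bsub>?R\<^esub>"
    proof (rule ccontr)
      assume "\<not> ?thesis"
      \<comment> \<open>At the common level k + l, p divides x fewer than k times and y fewer than l
        times, hence the product fewer than k + l times, although the product is 0 modulo p ^ (k +
        l).\<close>
      then obtain k l where k: "x k \<noteq> 0" and l: "y l \<noteq> 0"
        by (auto simp: padic_integers_def fun_eq_iff)
      have xn: "\<not> int p ^ k dvd x (k + l)"
        using coherent[OF x, of k l] k by (simp add: dvd_eq_mod_eq_0)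
      have yn: "\<not> int p ^ l dvd y (k + l)"
        using coherent[OF y, of l k] l by (simp add: dvd_eq_mod_eq_0 add.commute)
      have "int p ^ (k + l) dvd x (k + l) * y (k + l)"
        using fun_cong[OF xy, of "k + l"] by (auto simp: padic_integers_def)
      moreover have "prime_elem (int p)"
        using p by simp
      ultimately obtain a b where ab: "a + b = k + l"
        and "int p ^ a dvd x (k + l)" "int p ^ b dvd y (k + l)"
        using prime_elem_power_dvd_prod by blast
      then have "\<not> k \<le> a" "\<not> l \<le> b"
        using xn yn by (meson dvd_trans le_imp_power_dvd)+
      then show False using ab by simp
    qed
  qed
qed

text \<open>The maximum in \<open>mat_rank\<close> is attained, the empty set of columns being
  independent, and a set of \<open>dim_col A\<close> column indices must contain all of
  them.\<close>

lemma independent_cols_if_max_rank: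
  assumes "mat_rank R A = dim_col A"
  shows "independent_cols R A {..<dim_col A}"
proof -
  let ?S = "{card J | J. J \<subseteq> {..<dim_col A} \<and> independent_cols R A J}"
  have "?S \<subseteq> card ` Pow {..<dim_col A}" by auto
  then have "finite ?S" by (rule finite_subset) simp
  moreover have "0 \<in> ?S"
    by (rule CollectI, rule exI[of _ "{}"]) (simp add: independent_cols_def)
  ultimately have "Max ?S \<in> ?S" by (intro Max_in) auto
  then obtain J where J: "J \<subseteq> {..<dim_col A}" "independent_cols R A J" "card J = dim_col A"
    using assms unfolding mat_rank_def by auto
  then have "J = {..<dim_col A}" by (intro card_subset_eq) auto
  with J show ?thesis by simp
qed

section \<open>The algebra attached to a symmetric matrix\<close>

lemma (in cring) finsum_delta:
  assumes "finite I" "j \<in> I" "f \<in> I \<rightarrow> carrier R"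
  shows "(\<Oplus>i\<in>I. (if i = j then \<one> else \<zero>) \<otimes> f i) = f j"
proof -
  have "(\<Oplus>i\<in>I. (if i = j then \<one> else \<zero>) \<otimes> f i) = (\<Oplus>i\<in>I. if i = j then f i else \<zero>)"
    by (rule finsum_cong') (use assms in \<open>auto simp: Pi_iff\<close>)
  also have "\<dots> = f j"
    by (rule add.finprod_singleton_swap) (use assms in auto)
  finally show ?thesis .
qed

text \<open>This is the bilinear form x^T A y, bracketed so that the inner sum is the i-th entry of
  A y.\<close>

definition form_value :: "('a, 'c) ring_scheme \<Rightarrow> nat \<Rightarrow> 'a mat \<Rightarrow> 'a vec \<Rightarrow> 'a vec \<Rightarrow> 'a" where
  "form_value R m A x y =
     (\<Oplus>\<^bsub>R\<^esub>i\<in>{..<m}. x $ i \<otimes>\<^bsub>R\<^esub> (\<Oplus>\<^bsub>R\<^esub>j\<in>{..<m}. y $ j \<otimes>\<^bsub>R\<^esub> A $$ (i, j)))"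

text \<open>With the rank written as \<open>Suc m\<close>, the distinguished last coordinate has
  index m. As \<open>carrier_vec\<close> fixes only the dimension, the coordinates are confined to
  \<open>carrier R\<close> separately.\<close>

definition form_algebra :: "('a, 'c) ring_scheme \<Rightarrow> nat \<Rightarrow> 'a mat \<Rightarrow> ('a, 'a vec) module" where
  "form_algebra R m A =
     \<lparr>carrier = {v \<in> carrier_vec (Suc m). \<forall>i<Suc m. v $ i \<in> carrier R},
      mult = (\<lambda>x y. vec (Suc m) (\<lambda>i. if i = m then form_value R m A x y else \<zero>\<^bsub>R\<^esub>)),
      one = vec (Suc m) (\<lambda>i. \<zero>\<^bsub>R\<^esub>),
      zero = vec (Suc m) (\<lambda>i. \<zero>\<^bsub>R\<^esub>),
      add = (\<lambda>x y. vec (Suc m) (\<lambda>i. x $ i \<oplus>\<^bsub>R\<^esub> y $ i)),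
      smult = (\<lambda>r x. vec (Suc m) (\<lambda>i. r \<otimes>\<^bsub>R\<^esub> x $ i))\<rparr>"

text \<open>Unit vectors whose 0 and 1 come from the ring record R rather than from a type
  class.\<close>

definition coord_vec :: "('a, 'c) ring_scheme \<Rightarrow> nat \<Rightarrow> nat \<Rightarrow> 'a vec" where
  "coord_vec R n j = vec n (\<lambda>i. if i = j then \<one>\<^bsub>R\<^esub> else \<zero>\<^bsub>R\<^esub>)"

text \<open>Symmetry makes the product commutative, and independence of the columns bounds the
  annihilator. The domain property gives torsion-freeness and, through \<one> \<noteq> \<zero>,
  distinct unit vectors.\<close>

locale symmetric_form = domain R for R (structure) +
  fixes m :: nat and A :: "'a mat"
  assumes A_carrier: "A \<in> carrier_mat m m"
    and A_elems: "elements_mat A \<subseteq> carrier R"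
    and A_sym: "transpose_mat A = A"
    and A_indep: "independent_cols R A {..<m}"
begin

abbreviation "M \<equiv> form_algebra R m A"
abbreviation "e \<equiv> coord_vec R (Suc m)"
abbreviation "form \<equiv> form_value R m A"

lemma carrier_M: "carrier M = {v \<in> carrier_vec (Suc m). \<forall>i<Suc m. v $ i \<in> carrier R}"
  and mult_M: "x \<otimes>\<^bsub>M\<^esub> y = vec (Suc m) (\<lambda>i. if i = m then form x y else \<zero>)"
  and zero_M: "\<zero>\<^bsub>M\<^esub> = vec (Suc m) (\<lambda>i. \<zero>)"
  and add_M: "x \<oplus>\<^bsub>M\<^esub> y = vec (Suc m) (\<lambda>i. x $ i \<oplus> y $ i)"
  and smult_M: "r \<odot>\<^bsub>M\<^esub> x = vec (Suc m) (\<lambda>i. r \<otimes> x $ i)"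
  by (simp_all add: form_algebra_def)

lemma coord_closed: "x \<in> carrier M \<Longrightarrow> i < Suc m \<Longrightarrow> x $ i \<in> carrier R"
  by (simp add: carrier_M)

lemma M_eqI:
  assumes "x \<in> carrier M" "y \<in> carrier M" "\<And>i. i < Suc m \<Longrightarrow> x $ i = y $ i"
  shows "x = y"
  using assms by (intro eq_vecI) (auto simp: carrier_M)

lemma entry_closed: "i < m \<Longrightarrow> j < m \<Longrightarrow> A $$ (i, j) \<in> carrier R"
  using A_elems A_carrier by blast

lemma entry_sym: "i < m \<Longrightarrow> j < m \<Longrightarrow> A $$ (i, j) = A $$ (j, i)"
  using A_carrier by (subst A_sym[symmetric]) simp

lemma row_closed:
  "y \<in> carrier M \<Longrightarrow> i < m \<Longrightarrow> (\<Oplus>j\<in>{..<m}. y $ j \<otimes> A $$ (i, j)) \<in> carrier R"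
  by (intro finsum_closed Pi_I m_closed) (auto simp: entry_closed coord_closed)

lemma form_closed:
  "x \<in> carrier M \<Longrightarrow> y \<in> carrier M \<Longrightarrow> form x y \<in> carrier R"
  unfolding form_value_def by (intro finsum_closed Pi_I m_closed) (auto simp: row_closed coord_closed entry_closed)

lemma form_add:
  assumes "x \<in> carrier M" "y \<in> carrier M" "z \<in> carrier M"
  shows "form (x \<oplus>\<^bsub>M\<^esub> y) z = form x z \<oplus> form y z"
proof -
  let ?r = "\<lambda>i. \<Oplus>j\<in>{..<m}. z $ j \<otimes> A $$ (i, j)"
  have "form (x \<oplus>\<^bsub>M\<^esub> y) z = (\<Oplus>i\<in>{..<m}. x $ i \<otimes> ?r i \<oplus> y $ i \<otimes> ?r i)"
    unfolding form_value_def
    by (rule finsum_cong') (use assms in \<open>auto simp: add_M l_distr row_closed coord_closed\<close>)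
  also have "\<dots> = form x z \<oplus> form y z"
    unfolding form_value_def
    by (rule finsum_addf) (use assms in \<open>auto simp: row_closed coord_closed\<close>)
  finally show ?thesis .
qed

lemma form_smult:
  assumes "r \<in> carrier R" "x \<in> carrier M" "y \<in> carrier M"
  shows "form (r \<odot>\<^bsub>M\<^esub> x) y = r \<otimes> form x y"
proof -
  let ?r = "\<lambda>i. \<Oplus>j\<in>{..<m}. y $ j \<otimes> A $$ (i, j)"
  have "form (r \<odot>\<^bsub>M\<^esub> x) y = (\<Oplus>i\<in>{..<m}. r \<otimes> (x $ i \<otimes> ?r i))"
    unfolding form_value_def
    by (rule finsum_cong') (use assms in \<open>auto simp: smult_M m_assoc row_closed coord_closed\<close>)
  also have "\<dots> = r \<otimes> form x y"
    unfolding form_value_def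
    by (rule finsum_rdistr[symmetric]) (use assms in \<open>auto simp: row_closed coord_closed\<close>)
  finally show ?thesis .
qed

text \<open>With x $ i moved inside the inner sum, the order of summation can be exchanged, as
  \<open>form_sym\<close> requires.\<close>

lemma form_expand:
  assumes "x \<in> carrier M" "y \<in> carrier M"
  shows "form x y = (\<Oplus>i\<in>{..<m}. \<Oplus>j\<in>{..<m}. x $ i \<otimes> (y $ j \<otimes> A $$ (i, j)))"
  unfolding form_value_def
  by (rule finsum_cong', simp)
    (use assms in \<open>auto simp: entry_closed coord_closed intro!: finsum_closed finsum_rdistr\<close>)

lemma form_sym:
  assumes x: "x \<in> carrier M" and y: "y \<in> carrier M"
  shows "form x y = form y x"
proof -
  have "form x y = (\<Oplus>j\<in>{..<m}. \<Oplus>i\<in>{..<m}. x $ i \<otimes> (y $ j \<otimes> A $$ (i, j)))"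
    unfolding form_expand[OF x y]
    by (rule finsum_finsum_swap) (use x y in \<open>auto simp: entry_closed coord_closed\<close>)
  \<comment> \<open>Symmetry of A exchanges the two indices of the entry, and commutativity of R the
    two coordinates.\<close>
  also have "\<dots> = (\<Oplus>j\<in>{..<m}. \<Oplus>i\<in>{..<m}. y $ j \<otimes> (x $ i \<otimes> A $$ (j, i)))"
    by (intro finsum_cong' refl)
      (use x y entry_sym in \<open>auto simp: entry_closed coord_closed m_lcomm intro!: finsum_closed\<close>)
  also have "\<dots> = form y x"
    by (rule form_expand[OF y x, symmetric])
  finally show ?thesis .
qed

section \<open>Algebra axioms, nilpotency and torsion-freeness\<close>

lemma mult_M_closed: "x \<in> carrier M \<Longrightarrow> y \<in> carrier M \<Longrightarrow> x \<otimes>\<^bsub>M\<^esub> y \<in> carrier M"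
  using form_closed by (auto simp: carrier_M mult_M)

lemma form_product_left:
  assumes "x \<in> carrier M" "y \<in> carrier M" "z \<in> carrier M"
  shows "form (x \<otimes>\<^bsub>M\<^esub> y) z = \<zero>"
proof -
  have "form (x \<otimes>\<^bsub>M\<^esub> y) z = (\<Oplus>i\<in>{..<m}. \<zero>)"
    unfolding form_value_def
    by (rule finsum_cong') (use assms in \<open>auto simp: mult_M row_closed\<close>)
  then show ?thesis by simp
qed

lemma triple_product:
  assumes "x \<in> carrier M" "y \<in> carrier M" "z \<in> carrier M"
  shows "x \<otimes>\<^bsub>M\<^esub> y \<otimes>\<^bsub>M\<^esub> z = \<zero>\<^bsub>M\<^esub>"
  \<comment> \<open>Only the outer product is unfolded, so that the inner one still matches
    \<open>form_product_left\<close>.\<close>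
  using form_product_left[OF assms] by (simp add: mult_M[of _ z] zero_M cong: if_cong)

lemma mult_M_comm:
  "x \<in> carrier M \<Longrightarrow> y \<in> carrier M \<Longrightarrow> x \<otimes>\<^bsub>M\<^esub> y = y \<otimes>\<^bsub>M\<^esub> x"
  by (simp add: mult_M form_sym cong: if_cong)

lemma module_M: "module R M"
proof (rule moduleI)
  show "cring R" by (rule is_cring)
  show "abelian_group M"
  proof (rule abelian_groupI)
    fix x assume x: "x \<in> carrier M"
    show "\<exists>y\<in>carrier M. y \<oplus>\<^bsub>M\<^esub> x = \<zero>\<^bsub>M\<^esub>"
      by (rule bexI[of _ "vec (Suc m) (\<lambda>i. \<ominus> x $ i)"])
        (use x in \<open>auto simp: carrier_M add_M zero_M l_neg\<close>)
  qed (auto simp: carrier_M add_M zero_M a_ac intro!: eq_vecI)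
qed (auto simp: carrier_M add_M smult_M l_distr r_distr m_assoc)

sublocale M: module R M
  by (rule module_M)

lemma comm_nonunital_algebra_M: "comm_nonunital_algebra R M"
proof
  fix x y z assume x: "x \<in> carrier M" and y: "y \<in> carrier M" and z: "z \<in> carrier M"
  show "x \<otimes>\<^bsub>M\<^esub> y \<in> carrier M" by (rule mult_M_closed[OF x y])
  show "x \<otimes>\<^bsub>M\<^esub> y = y \<otimes>\<^bsub>M\<^esub> x" by (rule mult_M_comm[OF x y])
  show "x \<otimes>\<^bsub>M\<^esub> y \<otimes>\<^bsub>M\<^esub> z = x \<otimes>\<^bsub>M\<^esub> (y \<otimes>\<^bsub>M\<^esub> z)"
    \<comment> \<open>Both sides are zero: the right one becomes a left-bracketed triple product
      after commuting x past the product of y and z.\<close>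
    using x y z by (simp add: triple_product mult_M_comm[of x] mult_M_closed)
  show "(x \<oplus>\<^bsub>M\<^esub> y) \<otimes>\<^bsub>M\<^esub> z = x \<otimes>\<^bsub>M\<^esub> z \<oplus>\<^bsub>M\<^esub> y \<otimes>\<^bsub>M\<^esub> z"
    unfolding mult_M form_add[OF x y z] by (auto simp: add_M)
next
  fix r x y assume "r \<in> carrier R" and "x \<in> carrier M" and "y \<in> carrier M"
  then show "(r \<odot>\<^bsub>M\<^esub> x) \<otimes>\<^bsub>M\<^esub> y = r \<odot>\<^bsub>M\<^esub> (x \<otimes>\<^bsub>M\<^esub> y)"
    \<comment> \<open>The instance of \<open>smult_M\<close> unfolds the multiple of the product
      only, leaving the scaled argument of \<open>form\<close> to \<open>form_smult\<close>.\<close>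
    unfolding mult_M by (auto simp: form_smult smult_M[of _ "vec _ _"])
qed

lemma torsion_free_M: "torsion_free R M"
  unfolding torsion_free_def
proof (intro ballI impI)
  fix r x assume r: "r \<in> carrier R" and x: "x \<in> carrier M" and rx: "r \<odot>\<^bsub>M\<^esub> x = \<zero>\<^bsub>M\<^esub>"
  have "r \<otimes> x $ i = \<zero>" if "i < Suc m" for i
    using arg_cong[OF rx, of "\<lambda>v. v $ i"] that by (simp add: smult_M zero_M)
  then have "x $ i = \<zero>" if "i < Suc m" "r \<noteq> \<zero>" for i
    using that integral[of r] r coord_closed[OF x] by blast
  then show "r = \<zero> \<or> x = \<zero>\<^bsub>M\<^esub>"
    using M_eqI[OF x M.zero_closed] by (auto simp: zero_M)
qed

section \<open>The unit vectors as an ordered basis\<close>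

lemma coord_vec_closed: "e j \<in> carrier M"
  by (simp add: carrier_M coord_vec_def)

lemma coord_vec_image_closed: "e ` J \<subseteq> carrier M"
  using coord_vec_closed by blast

lemma inj_coord_vec: "inj_on e {..<Suc m}"
proof (rule inj_onI)
  fix i j assume "i \<in> {..<Suc m}" "e i = e j"
  then have "e i $ i = e j $ i" "i < Suc m" by simp_all
  then show "i = j" by (simp add: coord_vec_def split: if_splits)
qed

lemma coord_finsum:
  assumes "finite S" "f \<in> S \<rightarrow> carrier M" "i < Suc m"
  shows "(\<Oplus>\<^bsub>M\<^esub>s\<in>S. f s) $ i = (\<Oplus>s\<in>S. f s $ i)"
  using assms
proof (induction S rule: finite_induct)
  case empty
  then show ?case by (simp add: zero_M)
next
  case (insert s S)
  then have "(\<lambda>s. f s $ i) \<in> S \<rightarrow> carrier R" by (auto intro: coord_closed)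
  with insert show ?case by (simp add: add_M coord_closed)
qed

text \<open>Coefficients in \<open>lincomb\<close> are indexed by the vectors themselves.
  Injectivity of e turns the sum over vectors into a sum over indices, where coordinate i singles
  out one term.\<close>

lemma coord_lincomb:
  assumes J: "J \<subseteq> {..<Suc m}" and a: "a \<in> e ` J \<rightarrow> carrier R" and i: "i < Suc m"
  shows "M.lincomb a (e ` J) $ i = (if i \<in> J then a (e i) else \<zero>)"
proof -
  have fin: "finite J" using J finite_subset by blast
  have inj: "inj_on e J" using J inj_coord_vec inj_on_subset by blast
  have ac: "a (e j) \<in> carrier R" if "j \<in> J" for j using a that by blast
  have "M.lincomb a (e ` J) $ i = (\<Oplus>v\<in>e ` J. (a v \<odot>\<^bsub>M\<^esub> v) $ i)"
    unfolding M.lincomb_def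
    by (rule coord_finsum) (use fin ac i coord_vec_closed in auto)
  also have "\<dots> = (\<Oplus>j\<in>J. (a (e j) \<odot>\<^bsub>M\<^esub> e j) $ i)"
    by (rule finsum_reindex) (use inj ac i coord_vec_closed in \<open>auto intro: coord_closed\<close>)
  also have "\<dots> = (\<Oplus>j\<in>J. if j = i then a (e j) else \<zero>)"
    by (rule finsum_cong') (use ac i in \<open>auto simp: smult_M coord_vec_def\<close>)
  also have "\<dots> = (if i \<in> J then a (e i) else \<zero>)"
  proof (cases "i \<in> J")
    case True
    then show ?thesis
      using add.finprod_singleton_swap[OF True fin, of "\<lambda>j. a (e j)"] ac by auto
  next
    case False
    then have "(\<Oplus>j\<in>J. if j = i then a (e j) else \<zero>) = (\<Oplus>j\<in>J. \<zero>)"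
      by (intro finsum_cong') auto
    then show ?thesis using False by simp
  qed
  finally show ?thesis .
qed

text \<open>A general J serves two purposes: all indices give a generating set, and {m} gives the
  annihilator.\<close>

lemma span_coord_vecs:
  assumes J: "J \<subseteq> {..<Suc m}"
  shows "M.span (e ` J) = {v \<in> carrier M. \<forall>i<Suc m. i \<notin> J \<longrightarrow> v $ i = \<zero>}"
proof -
  have fin: "finite (e ` J)" using J finite_subset by blast
  note span = M.finite_span[OF fin coord_vec_image_closed]
  have closed: "M.lincomb a (e ` J) \<in> carrier M" if "a \<in> e ` J \<rightarrow> carrier R" for a
    using M.lincomb_closed[OF coord_vec_image_closed that] .
  have "v \<in> M.span (e ` J)"
    if v: "v \<in> carrier M" and v0: "\<forall>i<Suc m. i \<notin> J \<longrightarrow> v $ i = \<zero>" for v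
  proof -
    \<comment> \<open>The coefficient at a unit vector w is the coordinate of v at the index of w,
      recovered by inverting e on J.\<close>
    define a where "a = (\<lambda>w. v $ the_inv_into J e w)"
    have inj: "inj_on e J" using J inj_coord_vec inj_on_subset by blast
    have ae: "a (e j) = v $ j" if "j \<in> J" for j
      using that inj by (simp add: a_def the_inv_into_f_f)
    have a: "a \<in> e ` J \<rightarrow> carrier R"
      using J ae coord_closed[OF v] by auto
    have "v = M.lincomb a (e ` J)"
      by (rule M_eqI[OF v closed[OF a]]) (use ae v0 in \<open>auto simp: coord_lincomb[OF J a]\<close>)
    then show ?thesis unfolding span using a by blast
  qed
  then show ?thesis
    unfolding span using closed coord_lincomb[OF J] by (auto simp: span)
qed

lemma lin_indpt_coord_vecs: "M.lin_indpt (e ` {..<Suc m})"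
proof (rule M.finite_lin_indpt2)
  fix a assume a: "a \<in> e ` {..<Suc m} \<rightarrow> carrier R" and "M.lincomb a (e ` {..<Suc m}) = \<zero>\<^bsub>M\<^esub>"
  then show "\<forall>v\<in>e ` {..<Suc m}. a v = \<zero>"
    using coord_lincomb[OF subset_refl a] by (auto simp: zero_M)
qed (use coord_vec_image_closed in auto)

section \<open>The annihilator and the defining matrix\<close>

lemma form_coord_vec_left:
  assumes "i < m" "y \<in> carrier M"
  shows "form (e i) y = (\<Oplus>j\<in>{..<m}. y $ j \<otimes> A $$ (i, j))"
proof -
  have "form (e i) y
      = (\<Oplus>k\<in>{..<m}. (if k = i then \<one> else \<zero>) \<otimes> (\<Oplus>j\<in>{..<m}. y $ j \<otimes> A $$ (k, j)))"
    unfolding form_value_def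
    by (rule finsum_cong') (use assms in \<open>auto simp: coord_vec_def row_closed\<close>)
  also have "\<dots> = (\<Oplus>j\<in>{..<m}. y $ j \<otimes> A $$ (i, j))"
    by (rule finsum_delta) (use assms row_closed in auto)
  finally show ?thesis .
qed

lemma form_coord_vecs:
  assumes "i < m" "j < m"
  shows "form (e i) (e j) = A $$ (i, j)"
proof -
  have "form (e i) (e j) = (\<Oplus>k\<in>{..<m}. (if k = j then \<one> else \<zero>) \<otimes> A $$ (i, k))"
    unfolding form_coord_vec_left[OF assms(1) coord_vec_closed]
    by (rule finsum_cong') (use assms in \<open>auto simp: coord_vec_def entry_closed\<close>)
  also have "\<dots> = A $$ (i, j)"
    by (rule finsum_delta) (use assms entry_closed in auto)
  finally show ?thesis .
qed

lemma Ann_M: "Ann M = M.span {e m}"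
proof -
  have "x $ i = \<zero>" if x: "x \<in> Ann M" and i: "i < m" for x i
  proof -
    have xc: "x \<in> carrier M" using x by (simp add: Ann_def)
    have "(\<Oplus>j\<in>{..<m}. x $ j \<otimes> A $$ (k, j)) = \<zero>" if k: "k < m" for k
    proof -
      \<comment> \<open>The last coordinate of this product is, by symmetry of the form, the k-th
        entry of A x.\<close>
      have "x \<otimes>\<^bsub>M\<^esub> e k = \<zero>\<^bsub>M\<^esub>" using x coord_vec_closed by (simp add: Ann_def)
      from arg_cong[OF this, of "\<lambda>v. v $ m"] have "form x (e k) = \<zero>"
        by (simp add: mult_M zero_M)
      then show ?thesis
        using form_coord_vec_left[OF k xc] form_sym[OF xc coord_vec_closed] by simp
    qed
    \<comment> \<open>Now A x = 0 reads as a linear relation among the columns of A with the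
      coordinates of x as coefficients.\<close>
    moreover have "(\<lambda>j. x $ j) \<in> {..<m} \<rightarrow> carrier R"
      using coord_closed[OF xc] by auto
    ultimately show ?thesis
      using A_indep A_carrier i unfolding independent_cols_def by blast
  qed
  \<comment> \<open>Conversely, the form reads only the first m coordinates of x, so it vanishes
    when they do.\<close>
  moreover have "x \<in> Ann M" if x: "x \<in> carrier M" and x0: "\<forall>i<m. x $ i = \<zero>" for x
  proof -
    have "form x y = \<zero>" if "y \<in> carrier M" for y
    proof -
      have "form x y = (\<Oplus>i\<in>{..<m}. \<zero>)"
        unfolding form_value_def
        by (rule finsum_cong') (use x0 that row_closed in auto)
      then show ?thesis by simp
    qed
    then show ?thesis using x by (simp add: Ann_def mult_M zero_M cong: if_cong)
  qed
  ultimately have "Ann M = {v \<in> carrier M. \<forall>i<Suc m. i \<notin> {m} \<longrightarrow> v $ i = \<zero>}"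
    by (auto simp: less_Suc_eq) (simp add: Ann_def)
  then show ?thesis using span_coord_vecs[of "{m}"] by simp
qed

lemma defining_matrix_M: "defining_matrix R M (Suc m) e A"
  unfolding defining_matrix_def ordered_basis_def
proof (intro conjI allI impI)
  show "inj_on e {..<Suc m}" by (rule inj_coord_vec)
  show "e ` {..<Suc m} \<subseteq> carrier M" by (rule coord_vec_image_closed)
  show "M.lin_indpt (e ` {..<Suc m})" by (rule lin_indpt_coord_vecs)
  show "M.gen_set (e ` {..<Suc m})" using span_coord_vecs[OF subset_refl] by auto
  show "Ann M = M.span {e (Suc m - 1)}" using Ann_M by simp
  show "A \<in> carrier_mat (Suc m - 1) (Suc m - 1)" using A_carrier by simp
  show "elements_mat A \<subseteq> carrier R" by (rule A_elems)
  fix i j assume "i < Suc m - 1" "j < Suc m - 1"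
  then show "e i \<otimes>\<^bsub>M\<^esub> e j = A $$ (i, j) \<odot>\<^bsub>M\<^esub> e (Suc m - 1)"
    \<comment> \<open>Only e m is unfolded here; e i and e j stay folded for
      \<open>form_coord_vecs\<close>.\<close>
    by (auto simp: mult_M smult_M form_coord_vecs coord_vec_def[of _ _ m] entry_closed)
qed

end

theorem theorem5p6:
  fixes p n :: nat and \<Theta> :: "(nat \<Rightarrow> int) mat"
  assumes "prime p" and "odd p" and "n \<ge> 1"
    and "\<Theta> \<in> carrier_mat (n - 1) (n - 1)"
    and "elements_mat \<Theta> \<subseteq> carrier (padic_integers p)"
    and "transpose_mat \<Theta> = \<Theta>"
    and "mat_rank (padic_integers p) \<Theta> = n - 1"
  shows "\<exists>(M :: (nat \<Rightarrow> int, (nat \<Rightarrow> int) vec) module) e.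
           comm_nonunital_algebra (padic_integers p) M \<and>
           torsion_free (padic_integers p) M \<and>
           three_nilpotent M \<and>
           cyclic_submodule (padic_integers p) M (Ann M) \<and>
           defining_matrix (padic_integers p) M n e \<Theta>"
proof -
  have "independent_cols (padic_integers p) \<Theta> {..<n - 1}"
    using independent_cols_if_max_rank[of "padic_integers p" \<Theta>] assms by simp
  then interpret symmetric_form "padic_integers p" "n - 1" \<Theta>
    using padic_integers_domain[OF assms(1)] assms
    by (simp add: symmetric_form_def symmetric_form_axioms_def)
  have "three_nilpotent M"
    using triple_product by (simp add: three_nilpotent_def)
  moreover have "cyclic_submodule (padic_integers p) M (Ann M)"
    unfolding cyclic_submodule_def using Ann_M coord_vec_closed by blast
  moreover have "defining_matrix (padic_integers p) M n e \<Theta>"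
    \<comment> \<open>Since n \<ge> 1, \<open>Suc (n - 1)\<close> is n. For n = 1 the matrix is
      empty and the product is zero.\<close>
    using defining_matrix_M assms(3) by simp
  ultimately show ?thesis
    using comm_nonunital_algebra_M torsion_free_M by blast
qed

end
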